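(* Let $F$ be an arbitrary field and let $P$ be a Poisson algebra of dimension $1$ over $F$. Then $P$ is isomorphic to exactly one of the following Poisson algebras: (1) $P_{1,1}=Fa$ with $a^2=0$ and $[a,a]=0$; (2) $P_{1,2}=Fe$ with $e^2=e$ and $[e,e]=0$. The algebras $P_{1,1}$ and $P_{1,2}$ are not isomorphic.
   Context: A Poisson algebra over a field $F$ is an $F$-vector space $P$ with two $F$-bilinear operations: a commutative associative multiplication $(x,y)\mapsto xy$ (not assumed to have an identity) and a Lie multiplication $(x,y)\mapsto[x,y]$ (alternating, $[x,x]=0$ for all $x$, and satisfying the Jacobi identity), such that $[xy,z]=x[y,z]+y[x,z]$ for all $x,y,z\in P$. An isomorphism of Poisson algebras is an $F$-linear bijection preserving both multiplications. No restriction on $\operatorname{char}(F)$ is imposed. *)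

theory Defs
  imports Main "HOL.Vector_Spaces"
begin

text \<open>The underlying additive group is the type class structure on the whole type \<open>'p\<close>; the
  record collects the remaining operations.\<close>

record ('f, 'p) poisson_ops =
  smult :: "'f \<Rightarrow> 'p \<Rightarrow> 'p"
  mult :: "'p \<Rightarrow> 'p \<Rightarrow> 'p"
  lie :: "'p \<Rightarrow> 'p \<Rightarrow> 'p"

locale poisson_algebra = vector_space "smult P"
  for P :: "('f::field, 'p::ab_group_add) poisson_ops" +
  assumes mult_linear_left: "Vector_Spaces.linear (smult P) (smult P) (\<lambda>x. mult P x y)"
    and mult_linear_right: "Vector_Spaces.linear (smult P) (smult P) (\<lambda>y. mult P x y)"
    and mult_commute: "mult P x y = mult P y x"
    and mult_assoc: "mult P (mult P x y) z = mult P x (mult P y z)"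
    and lie_linear_left: "Vector_Spaces.linear (smult P) (smult P) (\<lambda>x. lie P x y)"
    and lie_linear_right: "Vector_Spaces.linear (smult P) (smult P) (\<lambda>y. lie P x y)"
    and lie_self: "lie P x x = 0"
    and jacobi: "lie P x (lie P y z) + lie P y (lie P z x) + lie P z (lie P x y) = 0"
    and leibniz: "lie P (mult P x y) z = mult P x (lie P y z) + mult P y (lie P x z)"

definition poisson_iso ::
  "('f::field, 'p::ab_group_add) poisson_ops \<Rightarrow> ('f, 'q::ab_group_add) poisson_ops \<Rightarrow> ('p \<Rightarrow> 'q) \<Rightarrow> bool"
  where "poisson_iso P Q f \<longleftrightarrow>
    Vector_Spaces.linear (smult P) (smult Q) f \<and> bij f \<and>
    (\<forall>x y. f (mult P x y) = mult Q (f x) (f y)) \<and>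
    (\<forall>x y. f (lie P x y) = lie Q (f x) (f y))"

definition poisson_isomorphic ::
  "('f::field, 'p::ab_group_add) poisson_ops \<Rightarrow> ('f, 'q::ab_group_add) poisson_ops \<Rightarrow> bool"
  where "poisson_isomorphic P Q \<longleftrightarrow> (\<exists>f. poisson_iso P Q f)"

text \<open>The one-dimensional space spanned by \<open>a\<close> (respectively \<open>e\<close>) is realised on the field
  itself: the scalar \<open>x\<close> stands for \<open>x a\<close> (respectively \<open>x e\<close>), so that the basis vector is \<open>1\<close>.
  Both products are the bilinear extensions of their values on the basis vector.\<close>

definition P11 :: "('f::field, 'f) poisson_ops"
  where "P11 = \<lparr> smult = (*), mult = (\<lambda>x y. 0), lie = (\<lambda>x y. 0) \<rparr>"

definition P12 :: "('f::field, 'f) poisson_ops"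
  where "P12 = \<lparr> smult = (*), mult = (*), lie = (\<lambda>x y. 0) \<rparr>"

lemma vector_space_field: "vector_space ((*) :: 'f::field \<Rightarrow> 'f \<Rightarrow> 'f)"
  by unfold_locales (simp_all add: algebra_simps)

lemma dim_field: "vector_space.dim ((*) :: 'f::field \<Rightarrow> 'f \<Rightarrow> 'f) UNIV = 1"
proof -
  interpret vector_space "(*) :: 'f \<Rightarrow> 'f \<Rightarrow> 'f" by (rule vector_space_field)
  have "independent {1}" by simp
  moreover have "UNIV \<subseteq> span {1}"
    by (auto simp: span_singleton)
  ultimately show ?thesis using dim_unique[of "{1}" UNIV 1] by simp
qed

lemma poisson_algebra_P11: "poisson_algebra (P11 :: ('f::field, 'f) poisson_ops)"
  unfolding P11_def by unfold_locales (simp_all add: algebra_simps)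

lemma poisson_algebra_P12: "poisson_algebra (P12 :: ('f::field, 'f) poisson_ops)"
  unfolding P12_def by unfold_locales (simp_all add: algebra_simps)

lemma dim_P11: "vector_space.dim (smult (P11 :: ('f::field, 'f) poisson_ops)) UNIV = 1"
  by (simp add: P11_def dim_field)

lemma dim_P12: "vector_space.dim (smult (P12 :: ('f::field, 'f) poisson_ops)) UNIV = 1"
  by (simp add: P12_def dim_field)

end

theory Submission
  imports Defs
begin

text \<open>
  A line has room for very little structure. If \<open>v\<close> spans it, the Lie product vanishes, because
  it is bilinear and \<open>[v,v] = 0\<close>; and the associative product is determined by the scalar \<open>k\<close>
  with \<open>v\<^sup>2 = k v\<close>. Either \<open>k = 0\<close>, and all products are zero, or rescaling turns \<open>v\<close> into the
  idempotent \<open>e = k\<^sup>-\<^sup>1 v\<close>, since \<open>e\<^sup>2 = k\<^sup>-\<^sup>2 k v = e\<close>. In each case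
  \<open>c \<mapsto> c v\<close> or \<open>c \<mapsto> c e\<close> is an isomorphism from the corresponding model on the field
  (lemmas \<open>P11_isomorphic_if_square_zero\<close> and \<open>P12_isomorphic_if_idempotent\<close>). No division by an
  integer occurs, so the characteristic does not matter.

  The two models are told apart by an isomorphism invariant: whether all associative products
  vanish.
\<close>

text \<open>
  Coordinates on a line are easiest to write in the direction \<open>c \<mapsto> c v\<close>, from the model into
  the algebra; this lemma turns such an isomorphism around.
\<close>

lemma poisson_iso_inv:
  assumes "poisson_iso Q P g"
  shows "poisson_iso P Q (inv g)"
proof -
  have lin: "Vector_Spaces.linear (smult Q) (smult P) g" and bij: "bij g"
    and m: "\<And>x y. g (mult Q x y) = mult P (g x) (g y)"
    and l: "\<And>x y. g (lie Q x y) = lie P (g x) (g y)"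
    using assms by (auto simp: poisson_iso_def)
  have inv_eq: "inv g y = x \<longleftrightarrow> g x = y" for x y
    using bij by (metis bij_inv_eq_iff)
  have g_inv: "g (inv g y) = y" for y
    using bij by (simp add: bij_is_surj surj_f_inv_f)
  from lin have "Vector_Spaces.linear (smult P) (smult Q) (inv g)"
    by (simp add: Vector_Spaces.linear_iff inv_eq g_inv)
  then show ?thesis
    using bij by (simp add: poisson_iso_def bij_imp_bij_inv inv_eq m l g_inv)
qed

context vector_space
begin

lemma dim_1_obtains_spanning_vector:
  assumes "dim UNIV = 1"
  obtains v where "v \<noteq> 0" "\<And>x. \<exists>c. x = scale c v"
proof -
  obtain B where B: "independent B" "UNIV \<subseteq> span B" "card B = dim UNIV"
    using basis_exists[of UNIV] by blast
  then obtain v where v: "B = {v}"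
    using assms by (metis card_1_singletonE)
  show thesis
  proof
    show "v \<noteq> 0" using B(1) v by (auto simp: dependent_zero)
    show "\<exists>c. x = scale c v" for x using B(2) v by (auto simp: span_singleton)
  qed
qed

lemma bij_scale_spanning_vector:
  assumes "v \<noteq> 0" "\<And>x. \<exists>c. x = scale c v"
  shows "bij (\<lambda>c. scale c v)"
proof (rule bijI)
  show "inj (\<lambda>c. scale c v)" using assms(1) by (auto intro: injI)
  show "surj (\<lambda>c. scale c v)" using assms(2) by (simp add: surj_def)
qed

lemma linear_scale_of_vector: "Vector_Spaces.linear (*) scale (\<lambda>c. scale c v)"
  by (simp add: Vector_Spaces.linear_iff vector_space_field vector_space_axioms scale_left_distrib)

end

context poisson_algebra
begin

lemma mult_scale_scale: "mult P (smult P c v) (smult P d v) = smult P (c * d) (mult P v v)"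
  using mult_linear_left mult_linear_right by (simp add: Vector_Spaces.linear_iff)

lemma lie_scale_scale: "lie P (smult P c v) (smult P d v) = 0"
  using lie_linear_left lie_linear_right by (simp add: Vector_Spaces.linear_iff lie_self)

lemma P11_isomorphic_if_square_zero:
  assumes "v \<noteq> 0" "\<And>x. \<exists>c. x = smult P c v" "mult P v v = 0"
  shows "poisson_isomorphic P P11"
proof -
  have "poisson_iso P11 P (\<lambda>c. smult P c v)"
    using assms bij_scale_spanning_vector[OF assms(1,2)]
    by (simp add: poisson_iso_def P11_def linear_scale_of_vector mult_scale_scale lie_scale_scale)
  then show ?thesis using poisson_iso_inv poisson_isomorphic_def by blast
qed

lemma P12_isomorphic_if_idempotent:
  assumes "e \<noteq> 0" "\<And>x. \<exists>c. x = smult P c e" "mult P e e = e"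
  shows "poisson_isomorphic P P12"
proof -
  have "poisson_iso P12 P (\<lambda>c. smult P c e)"
    using assms bij_scale_spanning_vector[OF assms(1,2)]
    by (simp add: poisson_iso_def P12_def linear_scale_of_vector mult_scale_scale lie_scale_scale)
  then show ?thesis using poisson_iso_inv poisson_isomorphic_def by blast
qed

lemma dim_1_classification:
  assumes "dim UNIV = 1"
  shows "poisson_isomorphic P P11 \<or> poisson_isomorphic P P12"
proof -
  obtain v where v: "v \<noteq> 0" "\<And>x. \<exists>c. x = smult P c v"
    using dim_1_obtains_spanning_vector[OF assms] by blast
  obtain k where k: "mult P v v = smult P k v" using v(2) by blast
  show ?thesis
  proof (cases "k = 0")
    case True
    then show ?thesis using P11_isomorphic_if_square_zero v k by simp
  next
    case False
    \<comment> \<open>The square scales by \<open>k\<^sup>-\<^sup>2\<close>, so this factor is the one that makes \<open>e\<close> idempotent.\<close>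
    define e where "e = smult P (inverse k) v"
    have "e \<noteq> 0" using False v(1) by (simp add: e_def)
    moreover have "\<exists>c. x = smult P c e" for x
    proof -
      obtain c where "x = smult P c v" using v(2) by blast
      then have "x = smult P (c * k) e" using False by (simp add: e_def)
      then show ?thesis ..
    qed
    moreover have "mult P e e = e"
      using False by (simp add: e_def mult_scale_scale k)
    ultimately show ?thesis using P12_isomorphic_if_idempotent by blast
  qed
qed

end

lemma poisson_iso_zero: "poisson_iso P Q f \<Longrightarrow> f 0 = 0"
  by (auto simp: poisson_iso_def Vector_Spaces.linear_def dest: module_hom.zero)

lemma mult_zero_if_isomorphic_P11:
  assumes "poisson_isomorphic P P11"
  shows "mult P x y = 0"
proof -
  obtain f where f: "poisson_iso P P11 f"
    using assms by (auto simp: poisson_isomorphic_def)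
  then have "f (mult P x y) = f 0"
    using poisson_iso_zero[OF f] by (simp add: poisson_iso_def P11_def)
  moreover have "inj f" using f by (simp add: poisson_iso_def bij_is_inj)
  ultimately show ?thesis by (simp add: inj_eq)
qed

lemma mult_nonzero_if_isomorphic_P12:
  assumes "poisson_isomorphic P P12"
  shows "\<exists>x. mult P x x \<noteq> 0"
proof -
  obtain f where f: "poisson_iso P P12 f"
    using assms by (auto simp: poisson_isomorphic_def)
  then obtain x where x: "f x = 1"
    by (metis poisson_iso_def bij_pointE)
  \<comment> \<open>The preimage of the idempotent \<open>1\<close> is a nonzero idempotent.\<close>
  have "f (mult P x x) = 1" using f x by (simp add: poisson_iso_def P12_def)
  then show ?thesis using poisson_iso_zero[OF f] by (metis zero_neq_one)
qed

theorem theorem3p1: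
  fixes P :: "('f::field, 'p::ab_group_add) poisson_ops"
  assumes "poisson_algebra P"
    and "vector_space.dim (smult P) UNIV = 1"
  shows "(poisson_isomorphic P (P11 :: ('f, 'f) poisson_ops) \<or>
          poisson_isomorphic P (P12 :: ('f, 'f) poisson_ops)) \<and>
         \<not> (poisson_isomorphic P (P11 :: ('f, 'f) poisson_ops) \<and>
            poisson_isomorphic P (P12 :: ('f, 'f) poisson_ops)) \<and>
         \<not> poisson_isomorphic (P11 :: ('f, 'f) poisson_ops) (P12 :: ('f, 'f) poisson_ops)"
proof (intro conjI)
  show "poisson_isomorphic P (P11 :: ('f, 'f) poisson_ops) \<or>
        poisson_isomorphic P (P12 :: ('f, 'f) poisson_ops)"
    using assms by (rule poisson_algebra.dim_1_classification)
  show "\<not> (poisson_isomorphic P (P11 :: ('f, 'f) poisson_ops) \<and>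
           poisson_isomorphic P (P12 :: ('f, 'f) poisson_ops))"
    using mult_zero_if_isomorphic_P11 mult_nonzero_if_isomorphic_P12 by blast
  show "\<not> poisson_isomorphic (P11 :: ('f, 'f) poisson_ops) (P12 :: ('f, 'f) poisson_ops)"
    using mult_nonzero_if_isomorphic_P12[of "P11 :: ('f, 'f) poisson_ops"]
    by (auto simp: P11_def)
qed

end
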